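(* Let $\alpha_1>0$ and $|\beta_1|<\alpha_1$, let $Q$ be the quantile function of the hyperbolic distribution $\mathrm{Hyp}(\alpha_1,\beta_1,1,0)$ with distribution function $F$, let $u_0\in(0,1)$, and let $x_0=Q(u_0)$. Then $Q$ admits, in a neighbourhood of $u_0$, the Taylor series expansion $$Q(u)=\sum_{n=0}^{\infty}q_n(u-u_0)^n,$$ where the coefficients are defined recursively by $$q_n=\begin{cases}x_0,&n=0\\ \frac{N_0}{n}b_{n-1},&n\ge1\end{cases},\qquad b_n=\begin{cases}e^{\alpha_1\sqrt{1+x_0^2}-\beta_1x_0},&n=0\\ \frac1n\sum_{k=1}^{n}k(\alpha_1a_k-\beta_1q_k)b_{n-k},&n\ge1\end{cases},$$ $$a_n=\begin{cases}\sqrt{1+x_0^2},&n=0\\ \frac{1}{na_0}\left(nq_nq_0+\sum_{k=0}^{n-2}(k+1)\left(q_{k+1}q_{n-k-1}-a_{k+1}a_{n-k-1}\right)\right),&n\ge1\end{cases},$$ and $N_0=2\alpha_1K_1(\gamma_1)/\gamma_1$ with $\gamma_1=\sqrt{\alpha_1^2-\beta_1^2}$.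
   Context: $K_\nu$ denotes the modified Bessel function of the second kind. The hyperbolic distribution $\mathrm{Hyp}(\alpha_1,\beta_1,1,0)$ (scale $\delta=1$, location $\mu=0$) has density on $\mathbb{R}$ $$f(x)=\frac{\gamma_1}{2\alpha_1K_1(\gamma_1)}e^{-\alpha_1\sqrt{1+x^2}+\beta_1x},\qquad \gamma_1=\sqrt{\alpha_1^2-\beta_1^2}.$$ $F(x)=\int_{-\infty}^xf(t)\,dt$ and the quantile function is $Q=F^{-1}:(0,1)\to\mathbb{R}$. Empty sums are zero. *)

theory Defs
  imports "HOL-Analysis.Analysis"
begin

text \<open>
  The modified Bessel function of the second kind, for real order and positive real argument,
  given by its standard integral representation (DLMF 10.32.9).
\<close>

definition bessel_K :: "real \<Rightarrow> real \<Rightarrow> real" where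
  "bessel_K \<nu> x = (LINT t:{0..}|lborel. exp (- x * cosh t) * cosh (\<nu> * t))"

definition hyp_gamma :: "real \<Rightarrow> real \<Rightarrow> real" where
  "hyp_gamma \<alpha> \<beta> = sqrt (\<alpha>\<^sup>2 - \<beta>\<^sup>2)"

definition hyp_density :: "real \<Rightarrow> real \<Rightarrow> real \<Rightarrow> real" where
  "hyp_density \<alpha> \<beta> x =
     hyp_gamma \<alpha> \<beta> / (2 * \<alpha> * bessel_K 1 (hyp_gamma \<alpha> \<beta>)) *
     exp (- \<alpha> * sqrt (1 + x\<^sup>2) + \<beta> * x)"

definition hyp_cdf :: "real \<Rightarrow> real \<Rightarrow> real \<Rightarrow> real" where
  "hyp_cdf \<alpha> \<beta> x = (LINT t:{..x}|lborel. hyp_density \<alpha> \<beta> t)"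

text \<open>Only meaningful on the open unit interval, which is the range of the distribution function.\<close>

definition hyp_quantile :: "real \<Rightarrow> real \<Rightarrow> real \<Rightarrow> real" where
  "hyp_quantile \<alpha> \<beta> = the_inv_into UNIV (hyp_cdf \<alpha> \<beta>)"

definition hyp_N0 :: "real \<Rightarrow> real \<Rightarrow> real" where
  "hyp_N0 \<alpha> \<beta> = 2 * \<alpha> * bessel_K 1 (hyp_gamma \<alpha> \<beta>) / hyp_gamma \<alpha> \<beta>"

text \<open>
  In the recursion for \<open>a\<close> the index set \<open>{..<n - 1}\<close> is the range from 0 to
  \<open>n - 2\<close>; it is empty for \<open>n = 1\<close>, whereas \<open>{0..n - 2}\<close> with
  truncated subtraction would not be.
\<close>

function hyp_q hyp_b hyp_a :: "real \<Rightarrow> real \<Rightarrow> real \<Rightarrow> nat \<Rightarrow> real" where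
  "hyp_q \<alpha> \<beta> x0 n =
     (if n = 0 then x0
      else hyp_N0 \<alpha> \<beta> / real n * hyp_b \<alpha> \<beta> x0 (n - 1))"
| "hyp_b \<alpha> \<beta> x0 n =
     (if n = 0 then exp (\<alpha> * sqrt (1 + x0\<^sup>2) - \<beta> * x0)
      else 1 / real n *
        (\<Sum>k\<in>{1..n}. real k * (\<alpha> * hyp_a \<alpha> \<beta> x0 k - \<beta> * hyp_q \<alpha> \<beta> x0 k)
                      * hyp_b \<alpha> \<beta> x0 (n - k)))"
| "hyp_a \<alpha> \<beta> x0 n =
     (if n = 0 then sqrt (1 + x0\<^sup>2)
      else 1 / (real n * hyp_a \<alpha> \<beta> x0 0) *
        (real n * hyp_q \<alpha> \<beta> x0 n * hyp_q \<alpha> \<beta> x0 0 +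
         (\<Sum>k\<in>{..<n - 1}. real (k + 1) *
            (hyp_q \<alpha> \<beta> x0 (k + 1) * hyp_q \<alpha> \<beta> x0 (n - k - 1)
             - hyp_a \<alpha> \<beta> x0 (k + 1) * hyp_a \<alpha> \<beta> x0 (n - k - 1)))))"
  by pat_completeness auto
termination
  by (relation "Wellfounded.measure (\<lambda>s. case s of
        Inl (_, _, _, n) \<Rightarrow> 3 * n
      | Inr (Inl (_, _, _, n)) \<Rightarrow> 3 * n + 2
      | Inr (Inr (_, _, _, n)) \<Rightarrow> 3 * n + 1)") auto

declare hyp_q.simps [simp del] hyp_b.simps [simp del] hyp_a.simps [simp del]

end

theory Submission imports Defs "HOL-Complex_Analysis.Complex_Analysis" begin

text \<open>
  The quantile function solves \<open>Q' = 1 / f(Q) = N\<^sub>0 exp (\<alpha> sqrt (1 + Q\<^sup>2) - \<beta> Q)\<close>. Extending the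
  right-hand side holomorphically to a disc about \<open>x\<^sub>0\<close>, the inverse of a complex primitive of its
  reciprocal is a holomorphic solution \<open>h\<close> with \<open>h 0 = x\<^sub>0\<close>. The identities \<open>h' = N\<^sub>0 b\<close>,
  \<open>b' = (\<alpha> a' - \<beta> h') b\<close> and \<open>a a' = h h'\<close> for \<open>a = sqrt (1 + h\<^sup>2)\<close> and \<open>b = exp (\<alpha> a - \<beta> h)\<close>
  are, coefficientwise, the three recursions, so \<open>h\<close> has Taylor coefficients \<open>q\<^sub>n\<close>. On the real
  axis \<open>(F \<circ> h)' = 1\<close>, hence \<open>F (h t) = u\<^sub>0 + t\<close>. That every \<open>u\<^sub>0\<close> in the unit interval is attained
  by \<open>F\<close> rests on the normalisation of the density.
\<close>

unbundle no vec_syntax \<comment> \<open>frees \<open>$\<close> for power series coefficients\<close>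

section \<open>Integrability and positivity of the Bessel integral\<close>

text \<open>Since \<open>cosh t >= sinh |t|\<close>, the integrand is at most
  \<open>exp (- \<gamma> * sinh |t|) * cosh t\<close>, which for \<open>t >= 0\<close> has the
  explicit primitive \<open>- exp (- \<gamma> * sinh t) / \<gamma>\<close>. The function
  \<open>m\<close> is this bound cut off to the half line; adding its reflection covers the whole
  line.\<close>

lemma integrable_exp_cosh_mult_cosh:
  fixes \<gamma> :: real
  assumes "\<gamma> > 0"
  shows "integrable lborel (\<lambda>t::real. exp (- \<gamma> * cosh t) * cosh t)"
proof -
  define m where "m = (\<lambda>t::real. exp (- \<gamma> * sinh t) * cosh t * indicator {0..} t)"
  have meas: "(\<lambda>t::real. exp (- \<gamma> * sinh t) * cosh t) \<in> borel_measurable borel"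
    by (intro borel_measurable_continuous_onI continuous_intros)
  have lim: "((\<lambda>t. - exp (- \<gamma> * sinh t) / \<gamma>) \<longlongrightarrow> 0) at_top"
  proof -
    have "filterlim (\<lambda>t. - \<gamma> * sinh t) at_bot at_top"
      using assms
      by (intro filterlim_tendsto_neg_mult_at_bot[OF tendsto_const _ sinh_real_at_top]) auto
    hence "((\<lambda>t. exp (- \<gamma> * sinh t)) \<longlongrightarrow> 0) at_top"
      by (rule filterlim_compose[OF exp_at_bot])
    from tendsto_divide[OF tendsto_minus[OF this] tendsto_const[of \<gamma>]] assms
    show ?thesis by simp
  qed
  have "(\<integral>\<^sup>+t. ennreal (exp (- \<gamma> * sinh t) * cosh t) * indicator {0..} t \<partial>lborel)
          = ennreal (0 - (- exp (- \<gamma> * sinh 0) / \<gamma>))"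
    by (intro nn_integral_FTC_atLeast lim meas)
       (use assms in \<open>auto intro!: derivative_eq_intros simp: field_simps\<close>)
  also have "(\<integral>\<^sup>+t. ennreal (exp (- \<gamma> * sinh t) * cosh t) * indicator {0..} t \<partial>lborel)
          = (\<integral>\<^sup>+t. ennreal (m t) \<partial>lborel)"
    unfolding m_def by (intro nn_integral_cong) (auto simp: indicator_def)
  finally have "integrable lborel m"
    using meas by (intro integrableI_nonneg) (auto simp: m_def)
  moreover from this have "integrable lborel (\<lambda>t. m (0 + (-1) * t))"
    by (intro lborel_integrable_real_affine) auto
  ultimately have "integrable lborel (\<lambda>t. m t + m (- t))"
    by (auto intro: Bochner_Integration.integrable_add)
  thus ?thesis
  proof (rule Bochner_Integration.integrable_bound)
    show "(\<lambda>t::real. exp (- \<gamma> * cosh t) * cosh t) \<in> borel_measurable lborel"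
      unfolding measurable_lborel2
      by (intro borel_measurable_continuous_onI continuous_intros)
    have "norm (exp (- \<gamma> * cosh t) * cosh t) \<le> norm (m t + m (- t))" for t :: real
    proof -
      have "exp (- \<gamma> * cosh t) * cosh t \<le> exp (- \<gamma> * sinh \<bar>t\<bar>) * cosh t"
        using assms sinh_le_cosh_real[of "\<bar>t\<bar>"] by (simp del: sinh_real_abs)
      also have "\<dots> \<le> m t + m (- t)"
        unfolding m_def by (cases "t \<ge> 0") (auto simp: indicator_def abs_if simp del: sinh_real_abs)
      finally show ?thesis by simp
    qed
    thus "AE t in lborel. norm (exp (- \<gamma> * cosh t) * cosh t) \<le> norm (m t + m (- t))"
      by simp
  qed
qed

lemma integrable_exp_cosh_mult_sinh:
  fixes \<gamma> :: real
  assumes "\<gamma> > 0"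
  shows "integrable lborel (\<lambda>t::real. exp (- \<gamma> * cosh t) * sinh t)"
  using integrable_exp_cosh_mult_cosh[OF assms]
proof (rule Bochner_Integration.integrable_bound)
  show "(\<lambda>t::real. exp (- \<gamma> * cosh t) * sinh t) \<in> borel_measurable lborel"
    unfolding measurable_lborel2
    by (intro borel_measurable_continuous_onI continuous_intros)
  have "\<bar>sinh t\<bar> \<le> cosh t" for t :: real
    using sinh_le_cosh_real[of t] sinh_le_cosh_real[of "- t"] by simp
  thus "AE t in lborel. norm (exp (- \<gamma> * cosh t) * sinh t)
                      \<le> norm (exp (- \<gamma> * cosh t) * cosh t :: real)"
    by (simp add: abs_mult)
qed

lemma lborel_integral_odd:
  fixes f :: "real \<Rightarrow> real"
  assumes "\<And>x. f (- x) = - f x"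
  shows "(\<integral>x. f x \<partial>lborel) = 0"
  using lborel_integral_real_affine[of "-1" f 0] assms by simp

lemma lborel_integral_even:
  fixes f :: "real \<Rightarrow> real"
  assumes "integrable lborel f" "\<And>x. f (- x) = f x"
  shows "(\<integral>x. f x \<partial>lborel) = 2 * (LINT x:{0..}|lborel. f x)"
proof -
  define g where "g = (\<lambda>x. indicator {0..} x *\<^sub>R f x)"
  have g: "integrable lborel g"
    unfolding g_def using assms(1) by (intro integrable_mult_indicator) auto
  have g': "integrable lborel (\<lambda>x. g (- x))"
    using lborel_integrable_real_affine[OF g, of "-1" 0] by simp
  \<comment> \<open>At \<open>x = 0\<close> both summands contribute \<open>f 0\<close>, so the
    identity holds only off a null set.\<close>
  have "AE x in lborel. f x = g x + g (- x)"
    using AE_lborel_singleton[of 0]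
    by eventually_elim (auto simp: g_def indicator_def assms(2))
  hence "(\<integral>x. f x \<partial>lborel) = (\<integral>x. g x + g (- x) \<partial>lborel)"
    using g g' assms(1) by (intro integral_cong_AE) auto
  also have "\<dots> = (\<integral>x. g x \<partial>lborel) + (\<integral>x. g (- x) \<partial>lborel)"
    using g g' by simp
  also have "(\<integral>x. g (- x) \<partial>lborel) = (\<integral>x. g x \<partial>lborel)"
    using lborel_integral_real_affine[of "-1" g 0] by simp
  finally show ?thesis
    by (simp add: g_def set_lebesgue_integral_def)
qed

text \<open>A nonnegative integrable function with integral zero vanishes almost everywhere, which a
  strictly positive integrand on a line of nonzero measure cannot do. This makes
  \<open>hyp_N0\<close> a legitimate divisor.\<close>

lemma bessel_K_1_pos:
  assumes "\<gamma> > 0"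
  shows "bessel_K 1 \<gamma> > 0"
proof -
  define k :: "real \<Rightarrow> real" where "k = (\<lambda>t. exp (- \<gamma> * cosh t) * cosh t)"
  have int: "integrable lborel k"
    unfolding k_def by (rule integrable_exp_cosh_mult_cosh[OF assms])
  have "integral\<^sup>L lborel k = 2 * bessel_K 1 \<gamma>"
    using lborel_integral_even[OF int] by (simp add: k_def bessel_K_def)
  moreover have "integral\<^sup>L lborel k > 0"
  proof -
    have "integral\<^sup>L lborel k \<noteq> 0"
    proof
      assume "integral\<^sup>L lborel k = 0"
      hence "AE t in lborel. k t = 0"
        using integral_nonneg_eq_0_iff_AE[OF int] by (auto simp: k_def)
      hence "AE t in (lborel :: real measure). False"
        by eventually_elim (simp add: k_def)
      thus False by (simp add: AE_iff_measurable[OF _ refl])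
    qed
    moreover have "integral\<^sup>L lborel k \<ge> 0"
      by (intro Bochner_Integration.integral_nonneg) (auto simp: k_def)
    ultimately show ?thesis by linarith
  qed
  ultimately show ?thesis by linarith
qed

section \<open>Normalisation of the density\<close>

lemma hyp_gamma_pos: "\<bar>\<beta>\<bar> < \<alpha> \<Longrightarrow> hyp_gamma \<alpha> \<beta> > 0"
  unfolding hyp_gamma_def using abs_le_square_iff[of \<alpha> \<beta>] by auto

lemma hyp_N0_pos: "\<bar>\<beta>\<bar> < \<alpha> \<Longrightarrow> hyp_N0 \<alpha> \<beta> > 0"
  unfolding hyp_N0_def using hyp_gamma_pos[of \<beta> \<alpha>] bessel_K_1_pos[of "hyp_gamma \<alpha> \<beta>"]
  by (auto intro!: mult_pos_pos divide_pos_pos)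

text \<open>In this form the density is visibly the reciprocal of the right-hand side of the
  differential equation for the quantile function.\<close>

lemma hyp_density_alt:
  "hyp_density \<alpha> \<beta> x = exp (- \<alpha> * sqrt (1 + x\<^sup>2) + \<beta> * x) / hyp_N0 \<alpha> \<beta>"
  by (simp add: hyp_density_def hyp_N0_def)

text \<open>
  Substitute \<open>x = sinh (t + \<phi>)\<close> with \<open>\<gamma> sinh \<phi> = \<beta>\<close> and \<open>\<gamma> cosh \<phi> = \<alpha>\<close>; the exponent
  becomes \<open>- \<gamma> cosh t\<close>.
\<close>
lemma hyp_density_integral:
  assumes "\<bar>\<beta>\<bar> < \<alpha>"
  shows "integrable lborel (hyp_density \<alpha> \<beta>)" "integral\<^sup>L lborel (hyp_density \<alpha> \<beta>) = 1"
proof -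
  define \<gamma> where "\<gamma> = hyp_gamma \<alpha> \<beta>"
  define \<phi> where "\<phi> = arsinh (\<beta> / \<gamma>)"
  define f where "f = (\<lambda>x. exp (- \<alpha> * sqrt (1 + x\<^sup>2) + \<beta> * x))"
  \<comment> \<open>The integrand after substitution, with \<open>cosh (t + \<phi>)\<close> expanded
    by the addition theorem: the \<open>cosh\<close> part is even and gives the Bessel function, the
    \<open>sinh\<close> part is odd and integrates to zero.\<close>
  define h where "h = (\<lambda>t. cosh \<phi> * (exp (- \<gamma> * cosh t) * cosh t) + sinh \<phi> * (exp (- \<gamma> * cosh t) * sinh t))"
  have \<gamma>: "\<gamma> > 0" unfolding \<gamma>_def by (rule hyp_gamma_pos[OF assms])
  have \<beta>_eq: "\<beta> = \<gamma> * sinh \<phi>" using \<gamma> by (simp add: \<phi>_def)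
  have \<gamma>2: "\<gamma>\<^sup>2 = \<alpha>\<^sup>2 - \<beta>\<^sup>2"
    using assms abs_le_square_iff[of \<alpha> \<beta>] by (simp add: \<gamma>_def hyp_gamma_def)
  have \<alpha>_eq: "\<alpha> = \<gamma> * cosh \<phi>"
  proof (rule power2_eq_imp_eq)
    have "(\<gamma> * cosh \<phi>)\<^sup>2 = \<gamma>\<^sup>2 + \<beta>\<^sup>2"
      by (simp add: \<beta>_eq power_mult_distrib cosh_square_eq algebra_simps)
    thus "\<alpha>\<^sup>2 = (\<gamma> * cosh \<phi>)\<^sup>2" using \<gamma>2 by simp
  qed (use assms \<gamma> in auto)
  have f_subst: "f (sinh (t + \<phi>)) * cosh (t + \<phi>) = h t" for t
  proof -
    have "sqrt (1 + (sinh (t + \<phi>))\<^sup>2) = cosh (t + \<phi>)"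
      by (rule real_sqrt_unique) (simp_all add: cosh_square_eq)
    \<comment> \<open>This is the subtraction formula for
      \<open>cosh ((t + \<phi>) - \<phi>)\<close> multiplied by \<gamma>.\<close>
    moreover have "\<alpha> * cosh (t + \<phi>) - \<beta> * sinh (t + \<phi>) = \<gamma> * cosh t"
      using arg_cong[OF cosh_diff[of "t + \<phi>" \<phi>], of "(*) \<gamma>"]
      by (simp add: \<alpha>_eq \<beta>_eq algebra_simps)
    ultimately have "f (sinh (t + \<phi>)) = exp (- \<gamma> * cosh t)"
      by (simp add: f_def algebra_simps)
    thus ?thesis by (simp add: h_def cosh_add algebra_simps)
  qed
  have int_h: "integrable lborel h"
    unfolding h_def using integrable_exp_cosh_mult_cosh[OF \<gamma>] integrable_exp_cosh_mult_sinh[OF \<gamma>]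
    by (intro Bochner_Integration.integrable_add integrable_mult_right) auto
  have "integral\<^sup>L lborel h = cosh \<phi> * (2 * bessel_K 1 \<gamma>)"
  proof -
    have "(\<integral>t. exp (- \<gamma> * cosh t) * sinh t \<partial>lborel) = 0"
      by (rule lborel_integral_odd) simp
    moreover have "(\<integral>t. exp (- \<gamma> * cosh t) * cosh t \<partial>lborel) = 2 * bessel_K 1 \<gamma>"
      using lborel_integral_even[OF integrable_exp_cosh_mult_cosh[OF \<gamma>]]
      by (simp add: bessel_K_def)
    ultimately show ?thesis
      unfolding h_def using integrable_exp_cosh_mult_cosh[OF \<gamma>] integrable_exp_cosh_mult_sinh[OF \<gamma>]
      by (subst Bochner_Integration.integral_add) auto
  qed
  also have "\<dots> = hyp_N0 \<alpha> \<beta>"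
    using \<gamma> by (simp add: hyp_N0_def flip: \<gamma>_def) (simp add: \<alpha>_eq)
  finally have val_h: "integral\<^sup>L lborel h = hyp_N0 \<alpha> \<beta>" .

  have "filterlim (\<lambda>t. t + \<phi>) at_top at_top"
    unfolding filterlim_at_top eventually_at_top_linorder
    by (metis diff_add_cancel add_le_cancel_right)
  hence top: "filterlim (\<lambda>t. sinh (t + \<phi>)) at_top at_top"
    by (rule filterlim_compose[OF sinh_real_at_top])
  have "filterlim (\<lambda>t. t + \<phi>) at_bot at_bot"
    unfolding filterlim_at_bot eventually_at_bot_linorder
    by (metis diff_add_cancel add_le_cancel_right)
  hence bot: "filterlim (\<lambda>t. sinh (t + \<phi>)) at_bot at_bot"
    by (rule filterlim_compose[OF sinh_real_at_bot])
  have A: "((ereal \<circ> (\<lambda>t. sinh (t + \<phi>)) \<circ> real_of_ereal) \<longlongrightarrow> -\<infinity>) (at_right (-\<infinity>))"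
    using bot by (simp add: ereal_tendsto_simps)
  have B: "((ereal \<circ> (\<lambda>t. sinh (t + \<phi>)) \<circ> real_of_ereal) \<longlongrightarrow> \<infinity>) (at_left \<infinity>)"
    using top by (simp add: ereal_tendsto_simps)
  have fg: "set_integrable lborel (einterval (-\<infinity>) \<infinity>) (\<lambda>t. f (sinh (t + \<phi>)) * cosh (t + \<phi>))"
    using int_h by (simp add: f_subst set_integrable_def)
  have deriv: "((\<lambda>t. sinh (t + \<phi>)) has_real_derivative cosh (x + \<phi>)) (at x)" for x
    by (auto intro!: derivative_eq_intros)
  have cont: "isCont f x" "isCont (\<lambda>t. cosh (t + \<phi>)) x" for x
    unfolding f_def by (intro continuous_intros)+
  have "(-\<infinity> :: ereal) < \<infinity>" "0 \<le> f x" "0 \<le> cosh (x + \<phi>)" for x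
    by (simp_all add: f_def)
  \<comment> \<open>For nonnegative integrands the substitution rule also transfers integrability,
    here from \<open>h\<close> back to \<open>f\<close>. The shifted \<open>sinh\<close> maps the
    line onto itself, so both endpoints stay infinite.\<close>
  note subst = interval_integral_substitution_nonneg
    [OF this(1) deriv cont this(2,3) A B fg]
  have f: "integrable lborel f" "integral\<^sup>L lborel f = hyp_N0 \<alpha> \<beta>"
    using subst val_h
    by (simp_all add: f_subst set_integrable_def interval_lebesgue_integral_def set_lebesgue_integral_def)
  have dens: "hyp_density \<alpha> \<beta> = (\<lambda>x. f x / hyp_N0 \<alpha> \<beta>)"
    by (auto simp: hyp_density_alt f_def)
  show "integrable lborel (hyp_density \<alpha> \<beta>)" "integral\<^sup>L lborel (hyp_density \<alpha> \<beta>) = 1"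
    unfolding dens using f hyp_N0_pos[OF assms] by simp_all
qed

section \<open>The distribution function: derivative, monotonicity, limits, inverse\<close>

lemma continuous_on_hyp_density: "continuous_on A (hyp_density \<alpha> \<beta>)"
  unfolding hyp_density_alt by (auto simp: divide_inverse intro!: continuous_intros)

text \<open>Cutting the integral at a fixed point left of \<open>x\<close> leaves a constant and an
  integral over a compact interval, to which the fundamental theorem of calculus applies.\<close>

lemma has_real_derivative_hyp_cdf:
  assumes "\<bar>\<beta>\<bar> < \<alpha>"
  shows "(hyp_cdf \<alpha> \<beta> has_real_derivative hyp_density \<alpha> \<beta> x) (at x)"
proof -
  define f where "f = hyp_density \<alpha> \<beta>"
  define a where "a = x - 1"
  have si: "set_integrable lborel A f" if "A \<in> sets lborel" for A
    unfolding set_integrable_def f_def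
    using hyp_density_integral(1)[OF assms] that by (intro integrable_mult_indicator) auto
  have split: "hyp_cdf \<alpha> \<beta> y = hyp_cdf \<alpha> \<beta> a + integral {a..y} f" if "a \<le> y" for y
  proof -
    \<comment> \<open>The pieces must be disjoint, hence the half-open \<open>{..<a}\<close>; the
      single point \<open>a\<close> has mass zero, so this piece still contributes
      \<open>hyp_cdf \<alpha> \<beta> a\<close>.\<close>
    have "{..y} = {..<a} \<union> {a..y}" "{..a} = {..<a} \<union> {a}" using that by auto
    moreover have "(LINT t:{..<a} \<union> {a..y}|lborel. f t) = (LINT t:{..<a}|lborel. f t) + (LINT t:{a..y}|lborel. f t)"
      by (intro set_integral_Un si) auto
    moreover have "(LINT t:{..<a} \<union> {a}|lborel. f t) = (LINT t:{..<a}|lborel. f t) + (LINT t:{a}|lborel. f t)"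
      by (intro set_integral_Un si) auto
    moreover have "(LINT t:{a}|lborel. f t) = 0"
      unfolding set_lebesgue_integral_def
    proof (rule integral_eq_zero_AE)
      show "AE t in lborel. indicator {a} t *\<^sub>R f t = 0"
        using AE_lborel_singleton[of a] by eventually_elim simp
    qed
    moreover have "(LINT t:{a..y}|lborel. f t) = integral {a..y} f"
      by (intro set_borel_integral_eq_integral si) auto
    ultimately show ?thesis by (simp add: hyp_cdf_def f_def)
  qed
  have "((\<lambda>y. integral {a..y} f) has_real_derivative f x) (at x within {a..x+1})"
    by (rule integral_has_real_derivative)
       (auto simp: a_def f_def intro: continuous_on_hyp_density)
  hence "((\<lambda>y. integral {a..y} f) has_real_derivative f x) (at x)"
    by (subst (asm) at_within_interior) (auto simp: a_def)
  hence "((\<lambda>y. hyp_cdf \<alpha> \<beta> a + integral {a..y} f) has_real_derivative f x) (at x)"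
    by (auto intro!: derivative_eq_intros)
  moreover
  have "\<forall>\<^sub>F y in nhds x. y \<in> {a<..}"
    by (rule eventually_nhds_in_open) (auto simp: a_def)
  hence "\<forall>\<^sub>F y in nhds x. hyp_cdf \<alpha> \<beta> a + integral {a..y} f = hyp_cdf \<alpha> \<beta> y"
    by eventually_elim (rule split[symmetric], simp)
  from DERIV_cong_ev[OF refl this refl] calculation show ?thesis
    by (simp add: f_def)
qed

lemma hyp_density_pos: "\<bar>\<beta>\<bar> < \<alpha> \<Longrightarrow> hyp_density \<alpha> \<beta> x > 0"
  by (simp add: hyp_density_alt hyp_N0_pos)

lemma strict_mono_hyp_cdf:
  assumes "\<bar>\<beta>\<bar> < \<alpha>"
  shows "strict_mono (hyp_cdf \<alpha> \<beta>)"
proof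
  fix x y :: real assume "x < y"
  thus "hyp_cdf \<alpha> \<beta> x < hyp_cdf \<alpha> \<beta> y"
  proof (rule DERIV_pos_imp_increasing)
    fix z
    show "\<exists>d. (hyp_cdf \<alpha> \<beta> has_real_derivative d) (at z) \<and> d > 0"
      using has_real_derivative_hyp_cdf[OF assms, of z] hyp_density_pos[OF assms, of z] by blast
  qed
qed

lemma hyp_cdf_at_top:
  assumes "\<bar>\<beta>\<bar> < \<alpha>"
  shows "(hyp_cdf \<alpha> \<beta> \<longlongrightarrow> 1) at_top"
  using tendsto_integral_at_top[OF sets_lborel hyp_density_integral(1)[OF assms]]
  by (simp add: hyp_density_integral(2)[OF assms] hyp_cdf_def[abs_def] set_lebesgue_integral_def)

text \<open>Reflecting \<open>x\<close> to \<open>- x\<close> writes the lower tail as one minus an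
  integral over \<open>{..y}\<close>, which reduces the claim to a limit at
  \<open>at_top\<close>.\<close>

lemma hyp_cdf_at_bot:
  assumes "\<bar>\<beta>\<bar> < \<alpha>"
  shows "(hyp_cdf \<alpha> \<beta> \<longlongrightarrow> 0) at_bot"
proof -
  define f where "f = hyp_density \<alpha> \<beta>"
  have int: "integrable lborel f" "integrable lborel (\<lambda>x. f (- x))"
    using hyp_density_integral(1)[OF assms] lborel_integrable_real_affine[of f "-1" 0]
    by (auto simp: f_def)
  have "hyp_cdf \<alpha> \<beta> (- y) = 1 - (\<integral>x. indicator {..y} x *\<^sub>R f (- x) \<partial>lborel)" for y
  proof -
    have "hyp_cdf \<alpha> \<beta> (- y) = (\<integral>x. indicator {..-y} (- x) *\<^sub>R f (- x) \<partial>lborel)"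
      unfolding hyp_cdf_def set_lebesgue_integral_def f_def
      by (subst lborel_integral_real_affine[of "-1" _ 0]) simp_all
    also have "\<dots> = (\<integral>x. f (- x) - indicator {..y} x *\<^sub>R f (- x) \<partial>lborel)"
    proof (rule integral_cong_AE)
      \<comment> \<open>The left side selects \<open>x >= y\<close>, the right side
        \<open>x > y\<close>; they differ only at \<open>y\<close>.\<close>
      show "AE x in lborel. indicator {..-y} (- x) *\<^sub>R f (- x) = f (- x) - indicator {..y} x *\<^sub>R f (- x)"
        using AE_lborel_singleton[of y] by eventually_elim (auto simp: indicator_def)
    qed (use int in \<open>auto intro!: borel_measurable_integrable borel_measurable_times borel_measurable_diff\<close>)
    also have "\<dots> = (\<integral>x. f (- x) \<partial>lborel) - (\<integral>x. indicator {..y} x *\<^sub>R f (- x) \<partial>lborel)"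
      using int by (intro Bochner_Integration.integral_diff integrable_mult_indicator) auto
    also have "(\<integral>x. f (- x) \<partial>lborel) = 1"
      using lborel_integral_real_affine[of "-1" f 0] hyp_density_integral(2)[OF assms]
      by (simp add: f_def)
    finally show ?thesis .
  qed
  moreover have "((\<lambda>y. 1 - (\<integral>x. indicator {..y} x *\<^sub>R f (- x) \<partial>lborel)) \<longlongrightarrow> 1 - (\<integral>x. f (- x) \<partial>lborel)) at_top"
    by (intro tendsto_intros tendsto_integral_at_top int) auto
  moreover have "(\<integral>x. f (- x) \<partial>lborel) = 1"
    using lborel_integral_real_affine[of "-1" f 0] hyp_density_integral(2)[OF assms]
    by (simp add: f_def)
  ultimately show ?thesis
    by (simp add: filterlim_at_bot_mirror)
qed

lemma hyp_cdf_surj: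
  assumes "\<bar>\<beta>\<bar> < \<alpha>" "u \<in> {0<..<1}"
  obtains x where "hyp_cdf \<alpha> \<beta> x = u"
proof -
  obtain a where a: "hyp_cdf \<alpha> \<beta> a < u"
    using order_tendstoD(2)[OF hyp_cdf_at_bot[OF assms(1)], of u] assms(2)
      eventually_happens'[OF trivial_limit_at_bot_linorder] by (metis greaterThanLessThan_iff)
  obtain b where b: "hyp_cdf \<alpha> \<beta> b > u"
    using order_tendstoD(1)[OF hyp_cdf_at_top[OF assms(1)], of u] assms(2)
      eventually_happens'[OF trivial_limit_at_top_linorder] by (metis greaterThanLessThan_iff)
  have "a < b"
    using a b strict_mono_less[OF strict_mono_hyp_cdf[OF assms(1)], of a b] by simp
  moreover have "\<forall>x. a \<le> x \<and> x \<le> b \<longrightarrow> isCont (hyp_cdf \<alpha> \<beta>) x"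
    using has_real_derivative_hyp_cdf[OF assms(1)] by (auto intro: DERIV_isCont)
  ultimately obtain x where "hyp_cdf \<alpha> \<beta> x = u"
    using IVT[of "hyp_cdf \<alpha> \<beta>" a u b] a b by auto
  thus ?thesis by (rule that)
qed

text \<open>Through this the quantile at \<open>u\<close> is found by exhibiting any point where the
  distribution function equals \<open>u\<close>.\<close>

lemma hyp_quantile_hyp_cdf:
  assumes "\<bar>\<beta>\<bar> < \<alpha>"
  shows "hyp_quantile \<alpha> \<beta> (hyp_cdf \<alpha> \<beta> x) = x"
  unfolding hyp_quantile_def
  by (intro the_inv_into_f_f strict_mono_imp_inj_on[OF strict_mono_hyp_cdf[OF assms]]) auto

section \<open>Holomorphic solution of the differential equation\<close>

text \<open>The solution of the autonomous equation \<open>h' = g \<circ> h\<close> is the inverse of a primitive of \<open>1 / g\<close>.\<close>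
lemma autonomous_ODE_holomorphic_solution:
  fixes g :: "complex \<Rightarrow> complex"
  assumes "convex S" "open S" "z0 \<in> S" "g holomorphic_on S" "\<And>z. z \<in> S \<Longrightarrow> g z \<noteq> 0"
  obtains h r where "r > 0" "h 0 = z0" "h ` ball 0 r \<subseteq> S"
    "\<And>w. w \<in> ball 0 r \<Longrightarrow> (h has_field_derivative g (h w)) (at w)"
proof -
  have inv_hol: "(\<lambda>z. 1 / g z) holomorphic_on S"
    using assms by (intro holomorphic_intros) auto
  obtain G where G0: "\<And>z. z \<in> S \<Longrightarrow> (G has_field_derivative 1 / g z) (at z within S)"
    by (rule holomorphic_convex_primitive'[OF assms(1,2) inv_hol], rule that)
  have G: "(G has_field_derivative 1 / g z) (at z)" if "z \<in> S" for z
    using G0[OF that] by (simp only: at_within_open[OF that assms(2)])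
  have G_hol: "G holomorphic_on S"
    using G \<open>open S\<close> by (auto simp: holomorphic_on_open)
  have G_deriv: "deriv G z = 1 / g z" if "z \<in> S" for z
    using G[OF that] by (rule DERIV_imp_deriv)
  obtain s where s: "s > 0" "ball z0 s \<subseteq> S" "inj_on G (ball z0 s)"
    using has_complex_derivative_locally_injective[OF G_hol \<open>z0 \<in> S\<close> \<open>open S\<close>] G_deriv assms by auto
  have G_hol': "G holomorphic_on ball z0 s"
    using G_hol s(2) by (rule holomorphic_on_subset)
  obtain k where k: "k holomorphic_on (G ` ball z0 s)"
      "\<And>z. z \<in> ball z0 s \<Longrightarrow> deriv G z * deriv k (G z) = 1"
      "\<And>z. z \<in> ball z0 s \<Longrightarrow> k (G z) = z"
    by (rule holomorphic_has_inverse[OF G_hol' open_ball s(3)], rule that)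
  \<comment> \<open>By the open mapping theorem the image contains a disc about \<open>G z0\<close>,
    on which the inverse \<open>k\<close> is defined.\<close>
  have op: "open (G ` ball z0 s)"
    by (rule open_mapping_thm3[OF G_hol' open_ball s(3)])
  moreover have "G z0 \<in> G ` ball z0 s" using s by auto
  ultimately obtain r where r: "r > 0" "ball (G z0) r \<subseteq> G ` ball z0 s"
    by (meson open_contains_ball)
  have in_img: "G z0 + w \<in> G ` ball z0 s" if "w \<in> ball 0 r" for w
    using r(2) that by (auto simp: dist_norm)
  show ?thesis
  \<comment> \<open>Shifting the argument by \<open>G z0\<close> places the initial value
    \<open>z0\<close> at \<open>w = 0\<close>.\<close>
  proof (rule that[of r "\<lambda>w. k (G z0 + w)"])
    show "r > 0" "k (G z0 + 0) = z0" using r s k(3) by auto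
    show "(\<lambda>w. k (G z0 + w)) ` ball 0 r \<subseteq> S"
      using in_img k(3) s(2) by fastforce
    fix w :: complex assume w: "w \<in> ball 0 r"
    obtain z where z: "z \<in> ball z0 s" "G z0 + w = G z" using in_img[OF w] by auto
    have "(k has_field_derivative deriv k (G z)) (at (G z))"
      using k(1) op z by (intro holomorphic_derivI) auto
    \<comment> \<open>The derivative of the inverse is the reciprocal of
      \<open>deriv G z = 1 / g z\<close>.\<close>
    moreover have "deriv k (G z) = g z"
    proof -
      have "z \<in> S" using z(1) s(2) by blast
      thus ?thesis using k(2)[OF z(1)] G_deriv[of z] assms(5)[of z] by (simp add: field_simps)
    qed
    ultimately have "(k has_field_derivative g z) (at (G z0 + w))" by (simp add: z(2))
    moreover have "((\<lambda>w. G z0 + w) has_field_derivative 1) (at w)"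
      by (auto intro!: derivative_eq_intros)
    ultimately have "((\<lambda>w. k (G z0 + w)) has_field_derivative g z * 1) (at w)"
      by (rule DERIV_chain2)
    thus "((\<lambda>w. k (G z0 + w)) has_field_derivative g (k (G z0 + w))) (at w)"
      using k(3)[OF z(1)] by (simp add: z(2))
  qed
qed

section \<open>From power series identities to the recursions\<close>

text \<open>The Cauchy product, with its index shifted by one to match the sum in the recursion for
  \<open>hyp_b\<close>.\<close>

lemma fps_mult_deriv_nth:
  fixes F G :: "'a :: comm_ring_1 fps"
  assumes "n > 0"
  shows "(fps_deriv F * G) $ (n - 1) = (\<Sum>k\<in>{1..n}. of_nat k * F $ k * G $ (n - k))"
proof -
  have "(\<Sum>k\<in>{1..n}. of_nat k * F $ k * G $ (n - k))
          = (\<Sum>i\<in>{0..n-1}. of_nat (i + 1) * F $ (i + 1) * G $ (n - (i + 1)))"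
    by (rule sum.reindex_bij_witness[of _ "\<lambda>i. i + 1" "\<lambda>k. k - 1"]) (use assms in auto)
  thus ?thesis by (simp add: fps_mult_nth)
qed

text \<open>Coefficient \<open>n - 1\<close> of the three identities determines the
  \<open>n\<close>-th coefficients in the order \<open>H\<close>, \<open>A\<close>,
  \<open>B\<close>: \<open>H\<close> needs \<open>B\<close> at \<open>n - 1\<close>,
  \<open>A\<close> needs \<open>H\<close> up to \<open>n\<close>, and \<open>B\<close> needs both up
  to \<open>n\<close>. One strong induction therefore treats all three series together.\<close>

lemma hyp_coefficients_unique:
  fixes H A B :: "complex fps"
  assumes H': "fps_deriv H = fps_const (of_real (hyp_N0 \<alpha> \<beta>)) * B"
    and B': "fps_deriv B = (fps_const (of_real \<alpha>) * fps_deriv A - fps_const (of_real \<beta>) * fps_deriv H) * B"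
    and A': "fps_deriv A * A = fps_deriv H * H"
    and H0: "H $ 0 = of_real x0" and A0: "A $ 0 = of_real (sqrt (1 + x0\<^sup>2))"
    and B0: "B $ 0 = of_real (exp (\<alpha> * sqrt (1 + x0\<^sup>2) - \<beta> * x0))"
  shows "H $ n = of_real (hyp_q \<alpha> \<beta> x0 n)"
proof -
  have "H $ n = of_real (hyp_q \<alpha> \<beta> x0 n) \<and> A $ n = of_real (hyp_a \<alpha> \<beta> x0 n) \<and>
        B $ n = of_real (hyp_b \<alpha> \<beta> x0 n)"
  proof (induction n rule: less_induct)
    case (less n)
    show ?case
    proof (cases "n = 0")
      case True
      thus ?thesis using H0 A0 B0 by (simp add: hyp_q.simps hyp_a.simps hyp_b.simps)
    next
      case n: False
      \<comment> \<open>Needed because solving for the coefficient of \<open>A\<close> divides by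
        \<open>A $ 0\<close>.\<close>
      have "A $ 0 \<noteq> 0" unfolding A0 of_real_eq_0_iff
        by (metis add_pos_nonneg less_numeral_extra(1,3) real_sqrt_eq_zero_cancel_iff zero_le_power2)
      have "fps_deriv H $ (n - 1) = of_real (hyp_N0 \<alpha> \<beta>) * B $ (n - 1)"
        unfolding H' by simp
      hence "of_nat n * H $ n = of_real (hyp_N0 \<alpha> \<beta>) * of_real (hyp_b \<alpha> \<beta> x0 (n - 1))"
        using n less.IH[of "n - 1"] by simp
      hence Hn: "H $ n = of_real (hyp_q \<alpha> \<beta> x0 n)"
        using n by (simp add: hyp_q.simps[of _ _ _ n] field_simps)

      \<comment> \<open>The last term, \<open>k = n - 1\<close>, is split off because it alone
        contains the new coefficient \<open>F $ n\<close> as derivative factor; what remains runs up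
        to \<open>n - 2\<close>, as in the recursion for \<open>hyp_a\<close>.\<close>
      have split: "(fps_deriv F * F) $ (n - 1)
          = of_nat n * F $ n * F $ 0 + (\<Sum>k<n - 1. of_nat (k + 1) * (F $ (k + 1) * F $ (n - k - 1)))"
        for F :: "complex fps"
      proof -
        have "(fps_deriv F * F) $ (n - 1) = (\<Sum>k<Suc (n - 1). of_nat (k + 1) * F $ (k + 1) * F $ (n - 1 - k))"
          by (simp add: fps_mult_nth atLeast0AtMost lessThan_Suc_atMost)
        also have "\<dots> = (\<Sum>k<n - 1. of_nat (k + 1) * F $ (k + 1) * F $ (n - 1 - k)) + of_nat n * F $ n * F $ 0"
          using n by (subst sum.lessThan_Suc) (auto simp del: of_nat_Suc)
        finally show ?thesis
          by (simp add: mult.assoc diff_diff_eq add.commute)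
      qed
      have "of_nat n * A $ n * A $ 0 = of_nat n * H $ n * H $ 0 +
              (\<Sum>k<n - 1. of_nat (k + 1) * (H $ (k + 1) * H $ (n - k - 1) - A $ (k + 1) * A $ (n - k - 1)))"
        using arg_cong[OF A', of "\<lambda>F. F $ (n - 1)"]
        unfolding split by (simp add: right_diff_distrib sum_subtractf algebra_simps)
      also have "(\<Sum>k<n - 1. of_nat (k + 1) * (H $ (k + 1) * H $ (n - k - 1) - A $ (k + 1) * A $ (n - k - 1)))
        = of_real (\<Sum>k<n - 1. real (k + 1) * (hyp_q \<alpha> \<beta> x0 (k + 1) * hyp_q \<alpha> \<beta> x0 (n - k - 1)
             - hyp_a \<alpha> \<beta> x0 (k + 1) * hyp_a \<alpha> \<beta> x0 (n - k - 1)))"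
        unfolding of_real_sum by (intro sum.cong refl) (simp add: less.IH)
      finally have "A $ n = of_real (1 / (real n * hyp_a \<alpha> \<beta> x0 0) * (real n * hyp_q \<alpha> \<beta> x0 n * hyp_q \<alpha> \<beta> x0 0 +
         (\<Sum>k<n - 1. real (k + 1) * (hyp_q \<alpha> \<beta> x0 (k + 1) * hyp_q \<alpha> \<beta> x0 (n - k - 1)
             - hyp_a \<alpha> \<beta> x0 (k + 1) * hyp_a \<alpha> \<beta> x0 (n - k - 1)))))"
        using n \<open>A $ 0 \<noteq> 0\<close> less.IH[of 0] by (simp add: Hn field_simps)
      hence An: "A $ n = of_real (hyp_a \<alpha> \<beta> x0 n)"
        using n by (subst hyp_a.simps) simp

      \<comment> \<open>The series of the exponent of \<open>b\<close>, so that the second identity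
        reads \<open>B' = C' B\<close>.\<close>
      define C where "C = fps_const (of_real \<alpha>) * A - fps_const (of_real \<beta>) * H"
      have "of_nat n * B $ n = (fps_deriv C * B) $ (n - 1)"
        using n arg_cong[OF B', of "\<lambda>F. F $ (n - 1)"] by (simp add: C_def)
      also have "\<dots> = (\<Sum>k\<in>{1..n}. of_nat k * C $ k * B $ (n - k))"
        by (rule fps_mult_deriv_nth) (use n in simp)
      also have "\<dots> = of_real (\<Sum>k\<in>{1..n}. real k * (\<alpha> * hyp_a \<alpha> \<beta> x0 k - \<beta> * hyp_q \<alpha> \<beta> x0 k)
                      * hyp_b \<alpha> \<beta> x0 (n - k))"
        unfolding of_real_sum
      proof (intro sum.cong refl)
        \<comment> \<open>The term \<open>k = n\<close> uses the values \<open>Hn\<close> and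
          \<open>An\<close> just obtained; the index of \<open>B\<close> is below \<open>n\<close>
          because \<open>k >= 1\<close>.\<close>
        fix k assume k: "k \<in> {1..n}"
        hence "H $ k = of_real (hyp_q \<alpha> \<beta> x0 k)" "A $ k = of_real (hyp_a \<alpha> \<beta> x0 k)"
          using less.IH[of k] Hn An by (cases "k = n"; force)+
        moreover have "B $ (n - k) = of_real (hyp_b \<alpha> \<beta> x0 (n - k))"
          using less.IH[of "n - k"] k by auto
        ultimately show "of_nat k * C $ k * B $ (n - k)
          = of_real (real k * (\<alpha> * hyp_a \<alpha> \<beta> x0 k - \<beta> * hyp_q \<alpha> \<beta> x0 k) * hyp_b \<alpha> \<beta> x0 (n - k))"
          by (simp add: C_def)
      qed
      finally have "B $ n = of_real (1 / real n * (\<Sum>k\<in>{1..n}. real k * (\<alpha> * hyp_a \<alpha> \<beta> x0 k - \<beta> * hyp_q \<alpha> \<beta> x0 k)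
                      * hyp_b \<alpha> \<beta> x0 (n - k)))"
        using n by (simp add: field_simps)
      hence "B $ n = of_real (hyp_b \<alpha> \<beta> x0 n)"
        using n by (subst hyp_b.simps) simp
      with Hn An show ?thesis by simp
    qed
  qed
  thus ?thesis by blast
qed

section \<open>The Taylor series of the solution on the real axis\<close>

text \<open>The real part of \<open>1 + z^2\<close> is \<open>1 + (Re z)^2 - (Im z)^2 > 0\<close>.
  This keeps the argument of \<open>csqrt\<close> off its branch cut.\<close>

lemma one_plus_square_notin_nonpos_Reals:
  assumes "\<bar>Im z\<bar> < 1"
  shows "1 + z\<^sup>2 \<notin> \<real>\<^sub>\<le>\<^sub>0"
proof -
  have "(Im z)\<^sup>2 < 1" using assms abs_square_less_1 by blast
  hence "Re (1 + z\<^sup>2) > 0"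
    by (simp add: power2_eq_square) (smt (verit) zero_le_square)
  thus ?thesis by (auto simp: complex_nonpos_Reals_iff)
qed

lemma hyp_q_sums_ODE_solution:
  fixes \<alpha> \<beta> x0 :: real
  assumes N0: "hyp_N0 \<alpha> \<beta> \<noteq> 0"
  obtains p :: "real \<Rightarrow> real" and r where "r > 0" "p 0 = x0"
    "\<And>t. \<bar>t\<bar> < r \<Longrightarrow> (\<lambda>n. hyp_q \<alpha> \<beta> x0 n * t ^ n) sums p t"
    "\<And>t. \<bar>t\<bar> < r \<Longrightarrow>
      (p has_real_derivative hyp_N0 \<alpha> \<beta> * exp (\<alpha> * sqrt (1 + (p t)\<^sup>2) - \<beta> * p t)) (at t)"
proof -
  \<comment> \<open>With a real centre, radius 1 forces \<open>|Im z| < 1\<close> throughout the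
    disc.\<close>
  define S where "S = ball (complex_of_real x0) 1"
  define root where "root = (\<lambda>z::complex. csqrt (1 + z\<^sup>2))"
  define D where "D = (\<lambda>z. exp (of_real \<alpha> * root z - of_real \<beta> * z))"
  define g where "g = (\<lambda>z. of_real (hyp_N0 \<alpha> \<beta>) * D z)"
  have nonpos: "1 + z\<^sup>2 \<notin> \<real>\<^sub>\<le>\<^sub>0" if "z \<in> S" for z
  proof (rule one_plus_square_notin_nonpos_Reals)
    show "\<bar>Im z\<bar> < 1"
      using that abs_Im_le_cmod[of "z - of_real x0"] by (simp add: S_def dist_norm norm_minus_commute)
  qed
  have "g holomorphic_on S"
    unfolding g_def D_def root_def by (intro holomorphic_intros nonpos)
  moreover have "g z \<noteq> 0" for z using N0 by (simp add: g_def D_def)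
  ultimately obtain h r where h: "r > 0" "h 0 = of_real x0" "h ` ball 0 r \<subseteq> S"
      "\<And>w. w \<in> ball 0 r \<Longrightarrow> (h has_field_derivative g (h w)) (at w)"
    using autonomous_ODE_holomorphic_solution[of S "of_real x0" g] unfolding S_def
    by (metis centre_in_ball convex_ball open_ball zero_less_one)
  have h_hol: "h holomorphic_on ball 0 r"
    using h(4) by (subst holomorphic_on_open) blast+
  define a where "a = (\<lambda>w. root (h w))"
  define b where "b = (\<lambda>w. D (h w))"
  have a_hol: "a holomorphic_on ball 0 r"
    unfolding a_def root_def using h(3) by (intro holomorphic_intros h_hol nonpos) auto
  have b_eq: "b = (\<lambda>w. exp (of_real \<alpha> * a w - of_real \<beta> * h w))"
    by (simp add: b_def D_def a_def)
  have b_hol: "b holomorphic_on ball 0 r"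
    unfolding b_eq by (intro holomorphic_intros h_hol a_hol)
  have h': "deriv h w = of_real (hyp_N0 \<alpha> \<beta>) * b w" if "w \<in> ball 0 r" for w
    using h(4)[OF that] by (simp add: DERIV_imp_deriv g_def b_def)
  have dh: "(h has_field_derivative deriv h w) (at w)" if "w \<in> ball 0 r" for w
    by (rule holomorphic_derivI[OF h_hol open_ball that])
  have da: "(a has_field_derivative deriv a w) (at w)" if "w \<in> ball 0 r" for w
    by (rule holomorphic_derivI[OF a_hol open_ball that])
  have b': "deriv b w = (of_real \<alpha> * deriv a w - of_real \<beta> * deriv h w) * b w" if "w \<in> ball 0 r" for w
  proof (rule DERIV_imp_deriv)
    show "(b has_field_derivative (of_real \<alpha> * deriv a w - of_real \<beta> * deriv h w) * b w) (at w)"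
      unfolding b_eq by (rule derivative_eq_intros dh[OF that] da[OF that] refl)+ simp
  qed
  \<comment> \<open>Both sides arise by differentiating \<open>a^2 = 1 + h^2\<close>, so no
    derivative of \<open>csqrt\<close> is computed.\<close>
  have a': "deriv a w * a w = deriv h w * h w" if "w \<in> ball 0 r" for w
  proof -
    have "((\<lambda>w. (a w)\<^sup>2) has_field_derivative 2 * (deriv a w * a w)) (at w)"
      using da[OF that] by (auto intro!: derivative_eq_intros)
    moreover have "((\<lambda>w. (a w)\<^sup>2) has_field_derivative 2 * (deriv h w * h w)) (at w)"
      unfolding a_def root_def power2_csqrt using dh[OF that] by (auto intro!: derivative_eq_intros)
    ultimately have "2 * (deriv a w * a w) = 2 * (deriv h w * h w)" by (rule DERIV_unique)
    thus ?thesis by simp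
  qed
  define H A B where "H = fps_expansion h 0" and "A = fps_expansion a 0" and "B = fps_expansion b 0"
  have exps: "h has_fps_expansion H" "a has_fps_expansion A" "b has_fps_expansion B"
    unfolding H_def A_def B_def
    using h(1) h_hol a_hol b_hol by (auto intro!: has_fps_expansion_fps_expansion[of "ball 0 r"])
  \<comment> \<open>Functions agreeing near 0 have the same expansion; this turns the pointwise
    identities on the disc into identities of power series.\<close>
  have fps_eqI: "F = G" if "f has_fps_expansion F" "g has_fps_expansion G" "\<And>w. w \<in> ball 0 r \<Longrightarrow> f w = g w"
    for f g :: "complex \<Rightarrow> complex" and F G
  proof -
    have "eventually (\<lambda>w. w \<in> ball 0 r) (nhds (0::complex))"
      using h(1) by (intro eventually_nhds_in_open) auto
    hence "eventually (\<lambda>w. f w = g w) (nhds 0)"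
      by eventually_elim (rule that(3))
    hence "g has_fps_expansion F"
      using that(1) has_fps_expansion_cong[of f g F F] by blast
    thus ?thesis using that(2) by (rule fps_expansion_unique_complex)
  qed
  have nth0: "F $ 0 = f 0" if "f has_fps_expansion F" for f :: "complex \<Rightarrow> complex" and F
    using has_fps_expansion_imp_0_eq_fps_nth_0[OF that] by simp
  have root_of_real: "root (of_real y) = of_real (sqrt (1 + y\<^sup>2))" for y :: real
  proof -
    have "csqrt (of_real (1 + y\<^sup>2)) = of_real (sqrt (1 + y\<^sup>2))"
      by (rule of_real_sqrt[symmetric]) simp
    thus ?thesis by (simp add: root_def)
  qed
  have a0: "a 0 = of_real (sqrt (1 + x0\<^sup>2))"
    by (simp add: a_def root_of_real h(2))
  have b0: "b 0 = of_real (exp (\<alpha> * sqrt (1 + x0\<^sup>2) - \<beta> * x0))"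
    using a0 by (simp add: b_def D_def h(2) a_def flip: exp_of_real)
  have H_nth: "H $ n = of_real (hyp_q \<alpha> \<beta> x0 n)" for n
  proof (rule hyp_coefficients_unique[of _ _ _ B A])
    show "fps_deriv H = fps_const (of_real (hyp_N0 \<alpha> \<beta>)) * B"
      by (rule fps_eqI[where f = "deriv h" and g = "\<lambda>w. of_real (hyp_N0 \<alpha> \<beta>) * b w", OF _ _ h'])
         (intro has_fps_expansion_mult has_fps_expansion_diff has_fps_expansion_const has_fps_expansion_deriv exps)+
    show "fps_deriv B = (fps_const (of_real \<alpha>) * fps_deriv A - fps_const (of_real \<beta>) * fps_deriv H) * B"
      by (rule fps_eqI[where f = "deriv b" and
             g = "\<lambda>w. (of_real \<alpha> * deriv a w - of_real \<beta> * deriv h w) * b w", OF _ _ b'])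
         (intro has_fps_expansion_mult has_fps_expansion_diff has_fps_expansion_const has_fps_expansion_deriv exps)+
    show "fps_deriv A * A = fps_deriv H * H"
      by (rule fps_eqI[where f = "\<lambda>w. deriv a w * a w" and g = "\<lambda>w. deriv h w * h w", OF _ _ a'])
         (intro has_fps_expansion_mult has_fps_expansion_diff has_fps_expansion_const has_fps_expansion_deriv exps)+
  qed (use nth0[OF exps(1)] nth0[OF exps(2)] nth0[OF exps(3)] h(2) a0 b0 in simp_all)
  have sums: "(\<lambda>n. of_real (hyp_q \<alpha> \<beta> x0 n * t ^ n)) sums h (of_real t)" if "\<bar>t\<bar> < r" for t
    using holomorphic_power_series[OF h_hol, of "of_real t"] that
    by (simp add: fps_expansion_def H_def flip: H_nth)
  define p where "p = (\<lambda>t. Re (h (of_real t)))"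
  have psums: "(\<lambda>n. hyp_q \<alpha> \<beta> x0 n * t ^ n) sums p t" if "\<bar>t\<bar> < r" for t
    using sums_Re[OF sums[OF that]] by (simp only: p_def Re_complex_of_real)
  \<comment> \<open>A convergent series with real terms has a real sum, so taking the real part in
    \<open>p\<close> loses nothing.\<close>
  have hp: "h (of_real t) = of_real (p t)" if "\<bar>t\<bar> < r" for t
    using sums_unique2[OF sums[OF that]] psums[OF that] sums_of_real by blast
  show ?thesis
  proof (rule that[OF h(1) _ psums])
    show "p 0 = x0" by (simp add: p_def h(2))
    fix t :: real assume t: "\<bar>t\<bar> < r"
    have "(h has_field_derivative g (h (of_real t))) (at (of_real t))"
      using t by (intro h(4)) auto
    hence "(p has_real_derivative Re (g (h (of_real t)))) (at t)"
      unfolding p_def by (rule has_field_derivative_Re[OF has_vector_derivative_real_field, unfolded o_def])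
    moreover have "g (of_real y) = of_real (hyp_N0 \<alpha> \<beta> * exp (\<alpha> * sqrt (1 + y\<^sup>2) - \<beta> * y))" for y
      by (simp add: g_def D_def root_of_real flip: exp_of_real)
    ultimately show "(p has_real_derivative hyp_N0 \<alpha> \<beta> * exp (\<alpha> * sqrt (1 + (p t)\<^sup>2) - \<beta> * p t)) (at t)"
      by (simp only: hp[OF t] Re_complex_of_real)
  qed
qed

section \<open>Identification of the series with the quantile function\<close>

theorem mainTheorem1:
  fixes \<alpha> \<beta> u0 x0 :: real
  assumes "\<alpha> > 0" and "\<bar>\<beta>\<bar> < \<alpha>"
    and "u0 \<in> {0<..<1}"
    and "x0 = hyp_quantile \<alpha> \<beta> u0"
  shows "\<exists>r>0. {u0 - r<..<u0 + r} \<subseteq> {0<..<1} \<and>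
           (\<forall>u\<in>{u0 - r<..<u0 + r}.
              (\<lambda>n. hyp_q \<alpha> \<beta> x0 n * (u - u0) ^ n) sums hyp_quantile \<alpha> \<beta> u)"
proof -
  note \<beta> = assms(2)
  \<comment> \<open>As \<open>u0\<close> is attained by the distribution function, the inverse in
    \<open>hyp_quantile\<close> yields a genuine preimage there.\<close>
  have cdf_x0: "hyp_cdf \<alpha> \<beta> x0 = u0"
    using hyp_cdf_surj[OF \<beta> assms(3)] hyp_quantile_hyp_cdf[OF \<beta>] assms(4) by metis
  have "hyp_N0 \<alpha> \<beta> \<noteq> 0"
    using hyp_N0_pos[OF \<beta>] by simp
  from hyp_q_sums_ODE_solution[OF this, of x0]
  obtain p r where p: "r > 0" "p 0 = x0"
      "\<And>t. \<bar>t\<bar> < r \<Longrightarrow> (\<lambda>n. hyp_q \<alpha> \<beta> x0 n * t ^ n) sums p t"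
      "\<And>t. \<bar>t\<bar> < r \<Longrightarrow>
        (p has_real_derivative hyp_N0 \<alpha> \<beta> * exp (\<alpha> * sqrt (1 + (p t)\<^sup>2) - \<beta> * p t)) (at t)"
    by metis
  \<comment> \<open>Along \<open>p\<close> the density and the speed of \<open>p\<close> are
    reciprocal, so \<open>hyp_cdf \<alpha> \<beta> (p t) - t\<close> has derivative zero and keeps
    its value \<open>u0\<close> at \<open>t = 0\<close>.\<close>
  have cdf_p: "hyp_cdf \<alpha> \<beta> (p t) = u0 + t" if t: "\<bar>t\<bar> < r" for t
  proof -
    have "((\<lambda>t. hyp_cdf \<alpha> \<beta> (p t) - t) has_real_derivative 0) (at s)" if "s \<in> {-r<..<r}" for s
    proof -
      have "((\<lambda>t. hyp_cdf \<alpha> \<beta> (p t)) has_real_derivative hyp_density \<alpha> \<beta> (p s) *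
              (hyp_N0 \<alpha> \<beta> * exp (\<alpha> * sqrt (1 + (p s)\<^sup>2) - \<beta> * p s))) (at s)"
        using that by (intro DERIV_chain2[OF has_real_derivative_hyp_cdf[OF \<beta>]] p(4)) auto
      also have "hyp_density \<alpha> \<beta> (p s) * (hyp_N0 \<alpha> \<beta> * exp (\<alpha> * sqrt (1 + (p s)\<^sup>2) - \<beta> * p s)) = 1"
        using hyp_N0_pos[OF \<beta>] by (simp add: hyp_density_alt flip: exp_add)
      finally show ?thesis
        using DERIV_diff[OF _ DERIV_ident] by fastforce
    qed
    hence "hyp_cdf \<alpha> \<beta> (p t) - t = hyp_cdf \<alpha> \<beta> (p 0) - 0"
      using t p(1) by (intro DERIV_isconst3[of "-r" r t 0 "\<lambda>t. hyp_cdf \<alpha> \<beta> (p t) - t"]) auto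
    thus ?thesis using cdf_x0 p(2) by simp
  qed
  \<comment> \<open>The radius is cut down so that the interval also stays inside the open unit
    interval.\<close>
  define R where "R = min r (min u0 (1 - u0))"
  have "R > 0" "{u0 - R<..<u0 + R} \<subseteq> {0<..<1}"
    using p(1) assms(3) by (auto simp: R_def)
  moreover have "(\<lambda>n. hyp_q \<alpha> \<beta> x0 n * (u - u0) ^ n) sums hyp_quantile \<alpha> \<beta> u"
    if "u \<in> {u0 - R<..<u0 + R}" for u
  proof -
    have u: "\<bar>u - u0\<bar> < r" using that by (auto simp: R_def)
    have "hyp_quantile \<alpha> \<beta> u = p (u - u0)"
      using hyp_quantile_hyp_cdf[OF \<beta>, of "p (u - u0)"] cdf_p[OF u] by simp
    thus ?thesis using p(3)[OF u] by simp
  qed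
  ultimately show ?thesis by blast
qed

end
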